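(* On the domain $\mathcal{D}_R=\{|z|\le R,\ y\in K\}$, with $R$ chosen so that $$2c_2\bigl(\Gamma_2+\varepsilon M_{DP}M_{D_xg}\bigr)R+2c_2C_fR^2\le\frac{\tilde\lambda}{4},$$ the effective decay rate $$\tilde\lambda:=1-2c_2\Gamma_1-\varepsilon M_{DP}M_g-\frac{\sigma^2}{2}M_{D^2P}M_h^2$$ is strictly positive, and the drift $\mathcal{L}V$ of $V(z,y)=z^TP(y)z$ satisfies $$\mathcal{L}V\le-\gamma_VV+D_0,\qquad\gamma_V=\frac{\tilde\lambda}{2c_2},$$ with $$D_0=\sigma^2c_2M_C^2M_h^2+\frac4{\tilde\lambda}\bigl(c_2\beta+\sigma^2M_{DP}M_CM_h^2\bigr)^2.$$
   Context: System. $dx=f(x,y)\,dt$, $dy=\varepsilon g(x,y)\,dt+\sigma h(y)\,dW_t$, $x\in\mathbb{R}^n$, $y\in\mathbb{R}^m$, $W$ a standard $d$-dimensional Brownian motion, $\varepsilon\ll1$, $\sigma>0$; $f\in C^4$, $g\in C^2$, $h\in C^2$, $h(y)\in\mathbb{R}^{m\times d}$. $K\subset\mathbb{R}^m$ is compact, $X^*\in C^3(K,\mathbb{R}^n)$ with $f(X^*(y),y)=0$ on $K$; $M_0=\{(X^*(y),y):y\in K\}$. $A(y)=D_xf(X^*(y),y)$, $\lambda_0=\inf_{y\in K}\min_i(-\mathrm{Re}\,\lambda_i(A(y)))>0$, and $\|e^{A(y)t}\|\le K_Ae^{-\lambda_0t}$ for all $t\ge0$, $y\in K$, with $K_A\ge1$.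 Deviation. $z=x-X^*(y)$; it satisfies $dz=[A(y)z+b(y)+N(z,y)]dt-\sigma DX^*(y)h(y)\,dW_t$, where $g_0(y)=g(X^*(y),y)$, $b(y)=-\varepsilon DX^*(y)g_0(y)-\frac{\sigma^2}{2}D^2X^*(y)[h(y)\otimes h(y)]$, and $N(z,y)=f(X^*+z,y)-A(y)z-\varepsilon DX^*(y)\bigl(g(X^*+z,y)-g_0(y)\bigr)$. Lyapunov matrix. $P(y)$ is the unique symmetric positive definite solution of $A(y)^TP(y)+P(y)A(y)=-I_n$, with bounds $c_1I\le P(y)\le c_2I$ on $K$, $c_1=\frac1{2\lambda_0K_A^2}$, $c_2=\frac{K_A^2}{2\lambda_0}$; $M_{DP}=\sup_K\|DP\|$, $M_{D^2P}=\sup_K\|D^2P\|$. $\mathcal{L}V$ is the Itô drift of $V(z(t),y(t))$: $$\mathcal{L}V=-|z|^2+2z^TPb+2z^TPN+\varepsilon z^TDP[g(X^*+z,y)]z+\sigma^2h^T(DX^* )^TP\,DX^*h+\tfrac{\sigma^2}{2}z^TD^2P[h\otimes h]z-2\sigma^2z^TDP[h]DX^*h,$$ where products quadratic in $h$ are summed over the columns $h_\ell$, $\ell=1,\dots,d$, of $h$ (e.g. the last term is $-2\sigma^2\sum_\ell z^TDP[h_\ell]DX^*h_\ell$). Constants (all finite). $U$ a neighbourhood of $M_0$ over $K$; $M_C=\sup_K\|DX^*\|$, $M_{C_2}=\sup_K\|D^2X^*\|$, $M_g=\sup_U\|g\|$, $M_{D_xg}=\sup_U\|D_xg\|$, $M_h=\sup_K\|h\|$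 (Frobenius norm), $M_B=\sup_K\|D_x^2f(X^*(y),y)\|$; other norms are operator norms (for bilinear maps, $\sup_{|u|=|v|=1}$). There are $R_0,C_f,C_g>0$ such that for $|z|\le R_0$, $y\in K$ the Taylor remainders in $f(X^*+z,y)=A(y)z+\frac12D_x^2f(X^*,y)[z,z]+R_f$ and $g(X^*+z,y)=g_0+D_xg(X^*,y)z+R_g$ satisfy $\|R_f\|\le C_f|z|^3$, $\|R_g\|\le C_g|z|^2$; the stopping radius satisfies $0<R\le R_0$. Set $\Gamma_1=\varepsilon M_CM_{D_xg}$, $\Gamma_2=\frac{M_B}{2}+\varepsilon M_CC_g$, $\beta=\varepsilon M_CM_g+\frac{\sigma^2}{2}M_{C_2}M_h^2$.
   Formalization: The neighbourhood U, over which the suprema M_g and M_{D_xg} are taken, is assumed to contain all points (X*(y)+z, y) with |z| ≤ R and y in K; for a thinner U the claim can fail. *)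

theory Defs
  imports "HOL-Analysis.Analysis"
begin

section \<open>Smoothness and derivatives\<close>

text \<open>C^k on a set \<open>S\<close>, meant for open \<open>S\<close> and a finite-dimensional domain: the derivative is
  continuous (or C^k) iff all directional derivatives are.\<close>

primrec Ck_on :: "nat \<Rightarrow> ('a::real_normed_vector \<Rightarrow> 'b::real_normed_vector) \<Rightarrow> 'a set \<Rightarrow> bool" where
  "Ck_on 0 F S \<longleftrightarrow> continuous_on S F"
| "Ck_on (Suc k) F S \<longleftrightarrow>
     (\<forall>x\<in>S. F differentiable (at x)) \<and> (\<forall>v. Ck_on k (\<lambda>x. frechet_derivative F (at x) v) S)"

text \<open>The Frechet derivative as a bounded linear map, so that \<open>norm\<close> is the operator norm.
  \<open>fderiv (fderiv F) x u v\<close> is the second derivative \<open>D\<^sup>2F(x)[u,v]\<close>, and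
  \<open>norm (fderiv (fderiv F) x)\<close> is its norm as a bilinear map.\<close>

definition fderiv ::
  "('a::real_normed_vector \<Rightarrow> 'b::real_normed_vector) \<Rightarrow> 'a \<Rightarrow> 'a \<Rightarrow>\<^sub>L 'b" where
  "fderiv F x = Blinfun (frechet_derivative F (at x))"

section \<open>Linear algebra\<close>

definition exp_op :: "('a::real_normed_vector \<Rightarrow>\<^sub>L 'a) \<Rightarrow> ('a \<Rightarrow>\<^sub>L 'a)" where
  "exp_op A = (\<Sum>k. (1 / fact k) *\<^sub>R (((o\<^sub>L) A ^^ k) id_blinfun))"

definition eigenvalues :: "((real^'n) \<Rightarrow>\<^sub>L (real^'n)) \<Rightarrow> complex set" where
  "eigenvalues A =
     {l. \<exists>v::complex^'n. v \<noteq> 0 \<and>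
           (\<chi> i j. complex_of_real (matrix (blinfun_apply A) $ i $ j)) *v v = l *s v}"

definition spd :: "('a::euclidean_space \<Rightarrow>\<^sub>L 'a) \<Rightarrow> bool" where
  "spd P \<longleftrightarrow> adjoint (blinfun_apply P) = blinfun_apply P \<and> (\<forall>u. u \<noteq> 0 \<longrightarrow> 0 < u \<bullet> P u)"

definition lyapunov_sol :: "('a::euclidean_space \<Rightarrow>\<^sub>L 'a) \<Rightarrow> ('a \<Rightarrow>\<^sub>L 'a)" where
  "lyapunov_sol A =
     (THE P. spd P \<and> (\<forall>u. adjoint (blinfun_apply A) (P u) + P (A u) = - u))"

section \<open>The fast-slow system near its slow manifold\<close>

text \<open>\<open>f\<close>, \<open>g\<close>, \<open>h\<close> are the coefficients, \<open>Xs\<close> parametrises the critical manifold, and the columns of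
  \<open>h y :: real^'d^'m\<close> are the noise directions.\<close>

definition A_lin ::
  "(real^'n \<Rightarrow> real^'m \<Rightarrow> real^'n) \<Rightarrow> (real^'m \<Rightarrow> real^'n) \<Rightarrow> real^'m
     \<Rightarrow> ((real^'n) \<Rightarrow>\<^sub>L (real^'n))" where
  "A_lin f Xs y = fderiv (\<lambda>x. f x y) (Xs y)"

definition spectral_gap ::
  "(real^'n \<Rightarrow> real^'m \<Rightarrow> real^'n) \<Rightarrow> (real^'m \<Rightarrow> real^'n) \<Rightarrow> (real^'m) set \<Rightarrow> real" where
  "spectral_gap f Xs K = (INF y\<in>K. Min ((\<lambda>l. - Re l) ` eigenvalues (A_lin f Xs y)))"

text \<open>If \<open>Xs\<close> is C^3 near \<open>K\<close> and \<open>A_lin f Xs\<close> is Hurwitz on \<open>K\<close>, it is Hurwitz near \<open>K\<close>, so \<open>P_lyap\<close> is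
  the Lyapunov solution on a neighbourhood of \<open>K\<close> and its derivatives on \<open>K\<close> are the usual ones.\<close>

definition P_lyap ::
  "(real^'n \<Rightarrow> real^'m \<Rightarrow> real^'n) \<Rightarrow> (real^'m \<Rightarrow> real^'n) \<Rightarrow> real^'m
     \<Rightarrow> ((real^'n) \<Rightarrow>\<^sub>L (real^'n))" where
  "P_lyap f Xs y = lyapunov_sol (A_lin f Xs y)"

definition V_lyap ::
  "(real^'n \<Rightarrow> real^'m \<Rightarrow> real^'n) \<Rightarrow> (real^'m \<Rightarrow> real^'n) \<Rightarrow> real^'n \<Rightarrow> real^'m \<Rightarrow> real" where
  "V_lyap f Xs z y = z \<bullet> P_lyap f Xs y z"

definition b_drift ::
  "(real^'n \<Rightarrow> real^'m \<Rightarrow> real^'m) \<Rightarrow> (real^'m \<Rightarrow> real^'d^'m) \<Rightarrow> (real^'m \<Rightarrow> real^'n)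
     \<Rightarrow> real \<Rightarrow> real \<Rightarrow> real^'m \<Rightarrow> real^'n" where
  "b_drift g h Xs eps sig y =
     - (eps *\<^sub>R fderiv Xs y (g (Xs y) y))
     - (sig\<^sup>2 / 2) *\<^sub>R (\<Sum>l\<in>UNIV. fderiv (fderiv Xs) y (column l (h y)) (column l (h y)))"

definition N_drift ::
  "(real^'n \<Rightarrow> real^'m \<Rightarrow> real^'n) \<Rightarrow> (real^'n \<Rightarrow> real^'m \<Rightarrow> real^'m) \<Rightarrow> (real^'m \<Rightarrow> real^'n)
     \<Rightarrow> real \<Rightarrow> real^'n \<Rightarrow> real^'m \<Rightarrow> real^'n" where
  "N_drift f g Xs eps z y =
     f (Xs y + z) y - A_lin f Xs y z
     - eps *\<^sub>R fderiv Xs y (g (Xs y + z) y - g (Xs y) y)"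

text \<open>The Ito drift of \<open>V(z,y) = z\<^sup>T P(y) z\<close> along
  \<open>dz = (A z + b + N) dt - sig DXs h dW\<close>, \<open>dy = eps g(Xs + z, y) dt + sig h dW\<close>; the contribution of
  \<open>A z\<close> is written as \<open>- |z|\<^sup>2\<close> by the Lyapunov equation.\<close>

definition LV ::
  "(real^'n \<Rightarrow> real^'m \<Rightarrow> real^'n) \<Rightarrow> (real^'n \<Rightarrow> real^'m \<Rightarrow> real^'m) \<Rightarrow> (real^'m \<Rightarrow> real^'d^'m)
     \<Rightarrow> (real^'m \<Rightarrow> real^'n) \<Rightarrow> real \<Rightarrow> real \<Rightarrow> real^'n \<Rightarrow> real^'m \<Rightarrow> real" where
  "LV f g h Xs eps sig z y =
     - (norm z)\<^sup>2
     + 2 * (z \<bullet> P_lyap f Xs y (b_drift g h Xs eps sig y))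
     + 2 * (z \<bullet> P_lyap f Xs y (N_drift f g Xs eps z y))
     + eps * (z \<bullet> fderiv (P_lyap f Xs) y (g (Xs y + z) y) z)
     + sig\<^sup>2 * (\<Sum>l\<in>UNIV. fderiv Xs y (column l (h y)) \<bullet>
                             P_lyap f Xs y (fderiv Xs y (column l (h y))))
     + sig\<^sup>2 / 2 * (\<Sum>l\<in>UNIV. z \<bullet>
         fderiv (fderiv (P_lyap f Xs)) y (column l (h y)) (column l (h y)) z)
     - 2 * sig\<^sup>2 * (\<Sum>l\<in>UNIV. z \<bullet>
         fderiv (P_lyap f Xs) y (column l (h y)) (fderiv Xs y (column l (h y))))"

end

theory Submission
  imports Defs
begin

text \<open>
  Write \<open>r = |z|\<close>. Cauchy-Schwarz, with the suprema for the norms of the coefficients and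
  \<open>\<parallel>P\<parallel> \<le> c2\<close>, bounds \<open>LV\<close> by a polynomial in \<open>r\<close> (\<open>LV_le\<close>). Its quadratic part is \<open>- lamt r\<^sup>2\<close>.
  The cubic and quartic terms come from the Taylor expansions of \<open>f\<close> and \<open>g\<close> inside \<open>N\<close>; for
  \<open>r \<le> R\<close> they are at most \<open>(2 c2 Gam2 R + 2 c2 Cf R\<^sup>2) r\<^sup>2\<close>, which the choice of \<open>R\<close> limits to
  \<open>(lamt / 4) r\<^sup>2\<close>. The term linear in \<open>r\<close> costs another \<open>(lamt / 4) r\<^sup>2\<close> by Young's inequality, the
  price being the second summand of \<open>D0\<close>; the constant term is the first summand. What is left,
  \<open>- (lamt / 2) r\<^sup>2 + D0\<close>, is at most \<open>- gamV V + D0\<close> because \<open>V \<le> c2 r\<^sup>2\<close>. Positivity of \<open>lamt\<close> can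
  be read off from the choice of \<open>R\<close>: the left-hand side of that inequality contains
  \<open>2 c2 Cf R\<^sup>2 > 0\<close>, and its other summands are nonnegative.

  The analytic content is that the matrix selected by \<open>lyapunov_sol\<close> really solves the Lyapunov
  equation and has norm at most \<open>c2\<close>. Both follow by differentiating \<open>v \<bullet> Q w\<close> along the flow
  \<open>exp (t A)\<close>: if \<open>A\<^sup>T Q + Q A = c I\<close>, the derivative is \<open>c\<close> times the inner product of two flow lines,
  so exponential decay gives \<open>v \<bullet> Q w \<le> \<bar>c\<bar> (KA\<^sup>2 / (2 lam)) |v| |w|\<close> (\<open>weak_lyapunov_bound\<close>). The case
  \<open>c = - 1\<close> is the bound on \<open>P\<close>; the case \<open>c = 0\<close> is uniqueness, and uniqueness gives existence
  because the Lyapunov operator is an endomorphism of a finite-dimensional space. Symmetry follows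
  from uniqueness, and positivity from \<open>v \<bullet> P v\<close> decreasing to \<open>0\<close> along the flow.
\<close>

section \<open>Suprema and sums over noise directions\<close>

lemma norm_le_SUP_norm:
  fixes F :: "'a \<Rightarrow> 'b::real_normed_vector"
  assumes "bounded (F ` S)" and "x \<in> S"
  shows "norm (F x) \<le> (SUP x\<in>S. norm (F x))"
proof (rule cSUP_upper)
  show "bdd_above ((\<lambda>x. norm (F x)) ` S)"
    using assms(1) by (simp add: bounded_norm_comp bounded_imp_bdd_above)
qed (fact assms(2))

lemma sum_norm_column_squared:
  fixes H :: "real^'d^'m"
  shows "(\<Sum>l\<in>UNIV. (norm (column l H))\<^sup>2) = (norm H)\<^sup>2"
proof -
  have "(\<Sum>l\<in>UNIV. (norm (column l H))\<^sup>2) = (\<Sum>l\<in>UNIV. \<Sum>i\<in>UNIV. H $ i $ l * H $ i $ l)"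
    by (simp add: power2_norm_eq_inner inner_vec_def column_def)
  also have "\<dots> = (\<Sum>i\<in>UNIV. \<Sum>l\<in>UNIV. H $ i $ l * H $ i $ l)"
    by (rule sum.swap)
  also have "\<dots> = (norm H)\<^sup>2"
    by (simp add: power2_norm_eq_inner inner_vec_def)
  finally show ?thesis .
qed

text \<open>The Frobenius norm enters only here: it is the norm for which a quadratic expression in the
  noise, summed over the columns, costs no dimensional factor.\<close>

lemma norm_sum_columns_le:
  fixes q :: "'d::finite \<Rightarrow> 'b::real_normed_vector" and H :: "real^'d^'m"
  assumes q: "\<And>l. norm (q l) \<le> C * (norm (column l H))\<^sup>2"
    and "0 \<le> C" "norm H \<le> M"
  shows "norm (\<Sum>l\<in>UNIV. q l) \<le> C * M\<^sup>2"
proof -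
  have "norm (\<Sum>l\<in>UNIV. q l) \<le> (\<Sum>l\<in>UNIV. C * (norm (column l H))\<^sup>2)"
    by (rule order_trans[OF norm_sum sum_mono]) (rule q)
  also have "\<dots> = C * (norm H)\<^sup>2"
    by (simp add: sum_distrib_left[symmetric] sum_norm_column_squared)
  also have "\<dots> \<le> C * M\<^sup>2"
    using assms(2,3) by (intro mult_left_mono power_mono) auto
  finally show ?thesis .
qed

lemma norm_blinfun_le:
  assumes "norm B \<le> b" "norm u \<le> a"
  shows "norm (blinfun_apply B u) \<le> b * a"
proof -
  have "0 \<le> b"
    using assms(1) norm_ge_zero order_trans by blast
  then have "norm B * norm u \<le> b * a"
    using assms by (intro mult_mono) auto
  then show ?thesis
    using norm_blinfun order_trans by blast
qed

lemma norm_blinfun2_le: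
  assumes "norm B \<le> b"
  shows "norm (blinfun_apply (blinfun_apply B u) v) \<le> b * norm u * norm v"
  by (intro norm_blinfun_le assms order_refl)

lemma norm_blinfun3_le:
  assumes "norm B \<le> b"
  shows "norm (blinfun_apply (blinfun_apply (blinfun_apply B u) v) w)
           \<le> b * norm u * norm v * norm w"
  by (intro norm_blinfun_le assms order_refl)

lemma abs_inner_le:
  assumes "norm v \<le> a"
  shows "\<bar>u \<bullet> v\<bar> \<le> norm u * a"
  using Cauchy_Schwarz_ineq2[of u v] mult_left_mono[OF assms norm_ge_zero[of u]] by linarith

section \<open>The flow of a linear vector field\<close>

lemma blinfun_funpow_apply:
  fixes A :: "'a::real_normed_vector \<Rightarrow>\<^sub>L 'a"
  shows "blinfun_apply (((o\<^sub>L) A ^^ k) id_blinfun) u = (blinfun_apply A ^^ k) u"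
  by (induction k) auto

lemma norm_blinfun_funpow_le:
  fixes A :: "'a::real_normed_vector \<Rightarrow>\<^sub>L 'a"
  shows "norm (((o\<^sub>L) A ^^ k) id_blinfun) \<le> norm A ^ k"
proof (induction k)
  case 0
  then show ?case by (simp add: norm_blinfun_id_le)
next
  case (Suc k)
  have "norm (((o\<^sub>L) A ^^ Suc k) id_blinfun) \<le> norm A * norm (((o\<^sub>L) A ^^ k) id_blinfun)"
    by (simp add: norm_blinfun_compose)
  also have "\<dots> \<le> norm A * norm A ^ k"
    by (intro mult_left_mono Suc.IH) auto
  finally show ?case by simp
qed

lemma exp_op_sums:
  fixes A :: "'a::banach \<Rightarrow>\<^sub>L 'a"
  shows "(\<lambda>k. (1 / fact k) *\<^sub>R (((o\<^sub>L) A ^^ k) id_blinfun)) sums exp_op A"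
  unfolding exp_op_def
proof (rule summable_sums, rule summable_comparison_test')
  show "summable (\<lambda>k. inverse (fact k) * norm A ^ k)"
    by (rule summable_exp)
  show "norm ((1 / fact k) *\<^sub>R (((o\<^sub>L) A ^^ k) id_blinfun)) \<le> inverse (fact k) * norm A ^ k" for k
    by (simp add: divide_inverse mult_left_mono norm_blinfun_funpow_le)
qed

lemma exp_op_scaleR_apply_sums:
  fixes A :: "'a::banach \<Rightarrow>\<^sub>L 'a"
  shows "(\<lambda>k. (t ^ k / fact k) *\<^sub>R (blinfun_apply A ^^ k) u) sums exp_op (t *\<^sub>R A) u"
proof -
  have pow: "(blinfun_apply (t *\<^sub>R A) ^^ k) u = t ^ k *\<^sub>R (blinfun_apply A ^^ k) u" for k
    by (induction k) (auto simp: scaleR_blinfun.rep_eq blinfun.scaleR_right)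
  have "bounded_linear (\<lambda>B::'a \<Rightarrow>\<^sub>L 'a. blinfun_apply B u)"
    by (rule bounded_linear_intros)+
  from bounded_linear.sums[OF this exp_op_sums[of "t *\<^sub>R A"]]
  show ?thesis
    by (simp add: blinfun.scaleR_left blinfun_funpow_apply pow divide_inverse mult.commute)
qed

lemma exp_op_zero_apply: "exp_op (0 *\<^sub>R A) u = u"
  for A :: "'a::banach \<Rightarrow>\<^sub>L 'a"
proof -
  have "(\<lambda>k. (0 ^ k / fact k) *\<^sub>R (blinfun_apply A ^^ k) u) sums
          (\<Sum>k\<in>{0}. (0 ^ k / fact k) *\<^sub>R (blinfun_apply A ^^ k) u)"
    by (rule sums_finite) auto
  from sums_unique2[OF exp_op_scaleR_apply_sums this] show ?thesis
    by simp
qed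

text \<open>Each coordinate of \<open>exp (t A) u\<close> is a real power series in \<open>t\<close>, so termwise differentiation of
  real series suffices; the differentiated series is the image of the series of \<open>exp (t A) u\<close> under
  the bounded functional \<open>x \<mapsto> A x \<bullet> w\<close>.\<close>

lemma exp_op_has_vector_derivative:
  fixes A :: "'a::euclidean_space \<Rightarrow>\<^sub>L 'a"
  shows "((\<lambda>t. exp_op (t *\<^sub>R A) u) has_vector_derivative A (exp_op (t *\<^sub>R A) u)) (at t)"
proof -
  have coord: "((\<lambda>t. exp_op (t *\<^sub>R A) u \<bullet> w) has_real_derivative A (exp_op (t *\<^sub>R A) u) \<bullet> w) (at t)"
    for w
  proof -
    define c where "c k = ((blinfun_apply A ^^ k) u \<bullet> w) / fact k" for k
    have sums: "(\<lambda>k. c k * s ^ k) sums (exp_op (s *\<^sub>R A) u \<bullet> w)" for s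
      using bounded_linear.sums[OF bounded_linear_inner_left exp_op_scaleR_apply_sums[of s A u], of w]
      by (simp add: c_def mult.commute)
    have diffs: "(\<lambda>k. diffs c k * t ^ k) sums (A (exp_op (t *\<^sub>R A) u) \<bullet> w)"
    proof -
      have "(t ^ k / fact k) * (A ((blinfun_apply A ^^ k) u) \<bullet> w) = diffs c k * t ^ k" for k
        by (simp add: c_def diffs_def divide_simps del: of_nat_Suc)
      with bounded_linear.sums[OF bounded_linear_compose[OF bounded_linear_inner_left[of w]
            blinfun.bounded_linear_right[of A]] exp_op_scaleR_apply_sums[of t A u]]
      show ?thesis
        by (simp add: blinfun.scaleR_right)
    qed
    have "((\<lambda>s. \<Sum>k. c k * s ^ k) has_real_derivative (\<Sum>k. diffs c k * t ^ k)) (at t)"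
      by (rule termdiffs_strong_converges_everywhere) (rule sums_summable[OF sums])
    then show ?thesis
      by (simp add: sums_unique[OF sums, symmetric] sums_unique[OF diffs, symmetric])
  qed
  show ?thesis
    unfolding has_vector_derivative_def
    by (subst has_derivative_componentwise_within)
      (use coord in \<open>simp add: has_field_derivative_def mult.commute[of _ "_ \<bullet> _"]\<close>)
qed

section \<open>The Lyapunov equation of an exponentially stable matrix\<close>

text \<open>The hypothesis is the equation \<open>A\<^sup>T Q + Q A = c I\<close> in weak form, which avoids adjoints; the
  product rule turns its left-hand side into a derivative along the flow.\<close>

lemma bilinear_form_along_flow_derivative:
  fixes A Q :: "'a::euclidean_space \<Rightarrow>\<^sub>L 'a"
  assumes "\<And>v w. A v \<bullet> Q w + v \<bullet> Q (A w) = c * (v \<bullet> w)"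
  shows "((\<lambda>t. exp_op (t *\<^sub>R A) v \<bullet> Q (exp_op (t *\<^sub>R A) w)) has_real_derivative
           c * (exp_op (t *\<^sub>R A) v \<bullet> exp_op (t *\<^sub>R A) w)) (at t)"
proof -
  have "((\<lambda>t. Q (exp_op (t *\<^sub>R A) w)) has_vector_derivative Q (A (exp_op (t *\<^sub>R A) w))) (at t)"
    by (rule bounded_linear.has_vector_derivative[OF blinfun.bounded_linear_right
          exp_op_has_vector_derivative])
  from bounded_bilinear.has_vector_derivative[OF bounded_bilinear_inner
      exp_op_has_vector_derivative[of A v t] this]
  show ?thesis
    using assms[of "exp_op (t *\<^sub>R A) v" "exp_op (t *\<^sub>R A) w"]
    by (simp add: has_real_derivative_iff_has_vector_derivative add.commute)
qed

lemma exp_neg_tendsto_0: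
  assumes "0 < (a::real)"
  shows "((\<lambda>t. exp (- a * t)) \<longlongrightarrow> 0) at_top"
proof -
  have "filterlim (\<lambda>t. a * t) at_top at_top"
    by (rule filterlim_tendsto_pos_mult_at_top[OF tendsto_const assms filterlim_ident])
  then show ?thesis
    by (auto intro!: filterlim_compose[OF exp_at_bot] simp: filterlim_uminus_at_top)
qed

text \<open>Applied to \<open>t \<mapsto> exp (t A) v \<bullet> Q (exp (t A) w)\<close>, up to a sign and a majorant, this
  yields estimates on \<open>Q\<close> without its integral representation
  \<open>Q = - c \<integral> exp (t A)\<^sup>T exp (t A) dt\<close> over \<open>[0, \<infinity>)\<close>.\<close>

lemma le_0_if_nondecreasing_to_0:
  fixes F F' :: "real \<Rightarrow> real"
  assumes "\<And>t. 0 \<le> t \<Longrightarrow> (F has_real_derivative F' t) (at t)"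
    and "\<And>t. 0 \<le> t \<Longrightarrow> 0 \<le> F' t"
    and "(F \<longlongrightarrow> 0) at_top"
  shows "F 0 \<le> 0"
proof (rule tendsto_lowerbound[OF assms(3)])
  show "\<forall>\<^sub>F t in at_top. F 0 \<le> F t"
    using eventually_ge_at_top[of "0::real"]
  proof eventually_elim
    case (elim t)
    then show ?case
      using assms(1,2) DERIV_nonneg_imp_nondecreasing[of 0 t F] by blast
  qed
qed auto

locale exponentially_stable =
  fixes A :: "'a::euclidean_space \<Rightarrow>\<^sub>L 'a" and KA lam :: real
  assumes lam_pos: "0 < lam"
    and decay: "\<And>t. 0 \<le> t \<Longrightarrow> norm (exp_op (t *\<^sub>R A)) \<le> KA * exp (- lam * t)"
begin

abbreviation flow :: "real \<Rightarrow> 'a \<Rightarrow> 'a" where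
  "flow t u \<equiv> blinfun_apply (exp_op (t *\<^sub>R A)) u"

lemma norm_flow_mult_le:
  assumes "0 \<le> t"
  shows "norm (flow t v) * norm (flow t w) \<le> KA\<^sup>2 * exp (- (2 * lam) * t) * (norm v * norm w)"
proof -
  have *: "norm (flow t u) \<le> KA * exp (- lam * t) * norm u" for u
    by (intro norm_blinfun_le decay assms order_refl)
  have "norm (flow t v) * norm (flow t w)
          \<le> (KA * exp (- lam * t) * norm v) * (KA * exp (- lam * t) * norm w)"
    by (intro mult_mono[OF * *] order_trans[OF norm_ge_zero *]) auto
  also have "\<dots> = KA\<^sup>2 * (exp (- lam * t) * exp (- lam * t)) * (norm v * norm w)"
    by (simp add: power2_eq_square)
  also have "exp (- lam * t) * exp (- lam * t) = exp (- (2 * lam) * t)"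
    by (simp add: mult_exp_exp)
  finally show ?thesis .
qed

lemma bilinear_form_along_flow_tendsto_0:
  "((\<lambda>t. flow t v \<bullet> blinfun_apply Q (flow t w)) \<longlongrightarrow> 0) at_top"
proof (rule Lim_null_comparison)
  show "((\<lambda>t. (norm Q * KA\<^sup>2 * (norm v * norm w)) * exp (- (2 * lam) * t)) \<longlongrightarrow> 0) at_top"
    using lam_pos by (intro tendsto_mult_right_zero exp_neg_tendsto_0) auto
  show "\<forall>\<^sub>F t in at_top. norm (flow t v \<bullet> Q (flow t w))
          \<le> (norm Q * KA\<^sup>2 * (norm v * norm w)) * exp (- (2 * lam) * t)"
    using eventually_ge_at_top[of "0::real"]
  proof eventually_elim
    case (elim t)
    have "norm (flow t v \<bullet> Q (flow t w)) \<le> norm Q * (norm (flow t v) * norm (flow t w))"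
      using abs_inner_le[OF norm_blinfun[of Q "flow t w"], of "flow t v"]
      by (simp add: mult.left_commute)
    also have "\<dots> \<le> norm Q * (KA\<^sup>2 * exp (- (2 * lam) * t) * (norm v * norm w))"
      by (intro mult_left_mono norm_flow_mult_le elim) auto
    finally show ?case by (simp add: algebra_simps)
  qed
qed

text \<open>The constant is \<open>\<bar>c\<bar>\<close> times the integral of \<open>KA\<^sup>2 exp (- 2 lam t)\<close> over \<open>[0, \<infinity>)\<close>. Allowing an
  arbitrary \<open>c\<close> makes \<open>c = 0\<close> a uniqueness statement and \<open>c = - 1\<close> a norm bound.\<close>

lemma weak_lyapunov_bound:
  assumes Q: "\<And>v w. A v \<bullet> blinfun_apply Q w + v \<bullet> blinfun_apply Q (A w) = c * (v \<bullet> w)"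
  shows "v \<bullet> blinfun_apply Q w \<le> \<bar>c\<bar> * (KA\<^sup>2 / (2 * lam)) * (norm v * norm w)"
proof -
  define a where "a = \<bar>c\<bar> * (KA\<^sup>2 / (2 * lam)) * (norm v * norm w)"
  \<comment> \<open>The correction term is the tail of the integral of the majorant of \<open>\<bar>c\<bar> \<bar>flow t v \<bullet> flow t w\<bar>\<close>.\<close>
  define F where "F t = flow t v \<bullet> Q (flow t w) - a * exp (- (2 * lam) * t)" for t
  have "F 0 \<le> 0"
  proof (rule le_0_if_nondecreasing_to_0)
    fix t :: real
    assume t: "0 \<le> t"
    have "((\<lambda>t. a * exp (- (2 * lam) * t)) has_real_derivative
            - (2 * lam * a * exp (- (2 * lam) * t))) (at t)"
      by (auto intro!: derivative_eq_intros)
    from DERIV_diff[OF bilinear_form_along_flow_derivative[OF Q, of v w t] this]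
    show "(F has_real_derivative
            (c * (flow t v \<bullet> flow t w) + 2 * lam * a * exp (- (2 * lam) * t))) (at t)"
      by (simp add: F_def[abs_def])
    have "\<bar>c * (flow t v \<bullet> flow t w)\<bar> \<le> \<bar>c\<bar> * (norm (flow t v) * norm (flow t w))"
      by (simp add: abs_mult mult_left_mono Cauchy_Schwarz_ineq2)
    also have "\<dots> \<le> \<bar>c\<bar> * (KA\<^sup>2 * exp (- (2 * lam) * t) * (norm v * norm w))"
      by (intro mult_left_mono norm_flow_mult_le t) auto
    also have "\<dots> = 2 * lam * a * exp (- (2 * lam) * t)"
      using lam_pos by (simp add: a_def field_simps)
    finally show "0 \<le> c * (flow t v \<bullet> flow t w) + 2 * lam * a * exp (- (2 * lam) * t)"
      by linarith
  next
    have "((\<lambda>t. a * exp (- (2 * lam) * t)) \<longlongrightarrow> 0) at_top"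
      using lam_pos by (intro tendsto_mult_right_zero exp_neg_tendsto_0) auto
    from tendsto_diff[OF bilinear_form_along_flow_tendsto_0[of v Q w] this]
    show "(F \<longlongrightarrow> 0) at_top"
      by (simp add: F_def[abs_def])
  qed
  then show ?thesis
    by (simp add: F_def a_def exp_op_zero_apply[unfolded scaleR_zero_left])
qed

lemma weak_lyapunov_homogeneous:
  assumes "\<And>v w. A v \<bullet> blinfun_apply Q w + v \<bullet> blinfun_apply Q (A w) = 0"
  shows "Q = 0"
proof (rule blinfun_eqI)
  fix w :: 'a
  have "blinfun_apply Q w \<bullet> blinfun_apply Q w
          \<le> \<bar>0\<bar> * (KA\<^sup>2 / (2 * lam)) * (norm (blinfun_apply Q w) * norm w)"
    by (rule weak_lyapunov_bound) (simp add: assms)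
  then have "blinfun_apply Q w \<bullet> blinfun_apply Q w \<le> 0"
    by simp
  then show "blinfun_apply Q w = blinfun_apply 0 w"
    by (metis blinfun.zero_left inner_gt_zero_iff not_le)
qed

lemma weak_lyapunov_unique:
  assumes "\<And>v w. A v \<bullet> blinfun_apply P w + v \<bullet> blinfun_apply P (A w) = c * (v \<bullet> w)"
    and "\<And>v w. A v \<bullet> blinfun_apply Q w + v \<bullet> blinfun_apply Q (A w) = c * (v \<bullet> w)"
  shows "P = Q"
proof -
  have "P - Q = 0"
  proof (rule weak_lyapunov_homogeneous)
    fix v w :: 'a
    show "A v \<bullet> blinfun_apply (P - Q) w + v \<bullet> blinfun_apply (P - Q) (A w) = 0"
      using assms(1)[of v w] assms(2)[of v w] by (simp add: blinfun.diff_left inner_diff_right)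
  qed
  then show ?thesis by simp
qed

lemma weak_lyapunov_spd:
  assumes P: "\<And>v w. A v \<bullet> blinfun_apply P w + v \<bullet> blinfun_apply P (A w) = - (v \<bullet> w)"
  shows "spd P"
proof -
  define Pt where "Pt = Blinfun (adjoint (blinfun_apply P))"
  have linP: "linear (blinfun_apply P)"
    by (rule bounded_linear.linear[OF blinfun.bounded_linear_right])
  have Pt: "blinfun_apply Pt = adjoint (blinfun_apply P)"
    unfolding Pt_def
    by (intro bounded_linear_Blinfun_apply) (simp add: linear_conv_bounded_linear[symmetric] adjoint_linear linP)
  \<comment> \<open>The transpose solves the same equation, so uniqueness makes the solution symmetric.\<close>
  have "Pt = P"
  proof (rule weak_lyapunov_unique[where c = "- 1"])
    fix v w :: 'a
    show "A v \<bullet> blinfun_apply Pt w + v \<bullet> blinfun_apply Pt (A w) = - 1 * (v \<bullet> w)"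
      using P[of w v] adjoint_works[OF linP] by (simp add: Pt inner_commute)
  qed (simp add: P)
  then have sym: "adjoint (blinfun_apply P) = blinfun_apply P"
    using Pt by simp
  have nonneg: "0 \<le> u \<bullet> P u" for u
  proof -
    have "- (flow 0 u \<bullet> P (flow 0 u)) \<le> 0"
    proof (rule le_0_if_nondecreasing_to_0[where F = "\<lambda>t. - (flow t u \<bullet> P (flow t u))"])
      fix t
      show "((\<lambda>t. - (flow t u \<bullet> P (flow t u))) has_real_derivative flow t u \<bullet> flow t u) (at t)"
        using DERIV_minus[OF bilinear_form_along_flow_derivative[of A P "-1" u u t]] P by simp
    qed (use tendsto_minus[OF bilinear_form_along_flow_tendsto_0[of u P u]] in auto)
    then show ?thesis
      by (simp add: exp_op_zero_apply[unfolded scaleR_zero_left])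
  qed
  \<comment> \<open>A zero of the form off the origin would make it negative a moment later along the flow.\<close>
  have "u \<bullet> P u \<noteq> 0" if "u \<noteq> 0" for u
  proof
    assume zero: "u \<bullet> P u = 0"
    have "((\<lambda>t. flow t u \<bullet> P (flow t u)) has_real_derivative - (u \<bullet> u)) (at 0)"
      using bilinear_form_along_flow_derivative[of A P "-1" u u 0] P
      by (simp add: exp_op_zero_apply[unfolded scaleR_zero_left])
    moreover have "- (u \<bullet> u) < 0"
      using that by simp
    ultimately obtain d where "0 < d"
      and d: "\<And>t. 0 < t \<Longrightarrow> t < d \<Longrightarrow> flow (0 + t) u \<bullet> P (flow (0 + t) u) < flow 0 u \<bullet> P (flow 0 u)"
      using DERIV_neg_dec_right by blast
    from d[of "d / 2"] \<open>0 < d\<close> zero have "flow (d / 2) u \<bullet> P (flow (d / 2) u) < 0"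
      by (simp add: exp_op_zero_apply[unfolded scaleR_zero_left])
    with nonneg show False
      by (meson not_le)
  qed
  with nonneg have "0 < u \<bullet> P u" if "u \<noteq> 0" for u
    using that by (metis order_le_less)
  with sym show ?thesis
    by (simp add: spd_def)
qed

end

text \<open>Existence is linear algebra: by uniqueness the Lyapunov operator
  \<open>M \<mapsto> A\<^sup>T M + M A\<close> on matrices is injective, hence surjective.\<close>

lemma weak_lyapunov_exists:
  fixes A :: "(real^'n) \<Rightarrow>\<^sub>L (real^'n)"
  assumes "exponentially_stable A KA lam"
  shows "\<exists>P. \<forall>v w. A v \<bullet> blinfun_apply P w + v \<bullet> blinfun_apply P (A w) = - (v \<bullet> w)"
proof -
  interpret exponentially_stable A KA lam by fact
  define MA where "MA = matrix (blinfun_apply A)"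
  have MA: "A v = MA *v v" for v
    unfolding MA_def
    by (simp add: matrix_works linear_conv_bounded_linear blinfun.bounded_linear_right)
  define L where "L M = transpose MA ** M + M ** MA" for M
  have L: "v \<bullet> (L M *v w) = A v \<bullet> (M *v w) + v \<bullet> (M *v A w)" for M v w
  proof -
    have "v \<bullet> (transpose MA *v u) = (MA *v v) \<bullet> u" for u
      by (metis dot_lmul_matrix vector_transpose_matrix)
    then show ?thesis
      by (simp add: L_def MA matrix_vector_mult_add_rdistrib inner_add_right
          matrix_vector_mul_assoc[symmetric])
  qed
  have "linear L"
    unfolding L_def
    by (rule linearI)
      (simp_all add: vec_eq_iff matrix_matrix_mult_def sum.distrib sum_distrib_left algebra_simps)
  have op: "blinfun_apply (Blinfun (\<lambda>w. M *v w)) = (\<lambda>w. M *v w)" for M :: "real^'n^'n"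
    by (simp add: bounded_linear_Blinfun_apply)
  have "M = 0" if "L M = 0" for M
  proof -
    have "Blinfun (\<lambda>w. M *v w) = 0"
      by (rule weak_lyapunov_homogeneous) (use L[of _ M] that in \<open>simp add: op\<close>)
    then have "M *v w = 0 *v w" for w
      using op by (metis matrix_vector_mult_0 zero_blinfun.rep_eq)
    then show "M = 0"
      by (simp add: matrix_eq)
  qed
  with \<open>linear L\<close> have "surj L"
    by (intro linear_injective_imp_surjective) (simp_all add: linear_injective_0)
  then obtain M where M: "L M = - mat 1"
    by (metis surjD)
  have "(- mat 1) *v w = - w" for w :: "real^'n"
    using matrix_vector_mult_diff_rdistrib[of 0 "mat 1" w] by simp
  then have "A v \<bullet> Blinfun (\<lambda>w. M *v w) w + v \<bullet> Blinfun (\<lambda>w. M *v w) (A w) = - (v \<bullet> w)" for v w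
    using L[of v M w] M by (simp add: op)
  then show ?thesis by blast
qed

lemma weak_lyapunov_iff:
  fixes A P :: "'a::euclidean_space \<Rightarrow>\<^sub>L 'a"
  shows "(\<forall>u. adjoint (blinfun_apply A) (P u) + P (A u) = - u)
           \<longleftrightarrow> (\<forall>v w. A v \<bullet> blinfun_apply P w + v \<bullet> blinfun_apply P (A w) = - (v \<bullet> w))"
proof -
  have "linear (blinfun_apply A)"
    by (rule bounded_linear.linear[OF blinfun.bounded_linear_right])
  then have "A v \<bullet> P w + v \<bullet> P (A w) = v \<bullet> (adjoint (blinfun_apply A) (P w) + P (A w))" for v w
    by (simp add: adjoint_works inner_add_right)
  moreover have "- (v \<bullet> w) = v \<bullet> (- w)" for v w :: 'a
    by simp
  ultimately show ?thesis
    by (metis vector_eq_rdot inner_commute)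
qed

text \<open>The definite description in \<open>lyapunov_sol\<close> denotes something only because a solution exists, is
  unique and is positive definite.\<close>

lemma lyapunov_sol_satisfies:
  fixes A :: "(real^'n) \<Rightarrow>\<^sub>L (real^'n)"
  assumes "exponentially_stable A KA lam"
  shows "A v \<bullet> blinfun_apply (lyapunov_sol A) w + v \<bullet> blinfun_apply (lyapunov_sol A) (A w)
           = - (v \<bullet> w)"
proof -
  interpret exponentially_stable A KA lam by fact
  obtain P where P: "\<And>v w. A v \<bullet> blinfun_apply P w + v \<bullet> blinfun_apply P (A w) = - (v \<bullet> w)"
    using weak_lyapunov_exists[OF assms] by blast
  have "lyapunov_sol A = P"
    unfolding lyapunov_sol_def weak_lyapunov_iff
  proof (rule the_equality)
    show "spd P \<and> (\<forall>v w. A v \<bullet> blinfun_apply P w + v \<bullet> blinfun_apply P (A w) = - (v \<bullet> w))"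
      using weak_lyapunov_spd P by blast
    show "Q = P"
      if "spd Q \<and> (\<forall>v w. A v \<bullet> blinfun_apply Q w + v \<bullet> blinfun_apply Q (A w) = - (v \<bullet> w))" for Q
      by (rule weak_lyapunov_unique[where c = "- 1"]) (use that P in auto)
  qed
  with P show ?thesis by simp
qed

lemma norm_lyapunov_sol_le:
  fixes A :: "(real^'n) \<Rightarrow>\<^sub>L (real^'n)"
  assumes "exponentially_stable A KA lam"
  shows "norm (lyapunov_sol A) \<le> KA\<^sup>2 / (2 * lam)"
proof (rule norm_blinfun_bound)
  interpret exponentially_stable A KA lam by fact
  show nonneg: "0 \<le> KA\<^sup>2 / (2 * lam)"
    using lam_pos by simp
  fix w :: "real^'n"
  let ?P = "blinfun_apply (lyapunov_sol A)"
  have "?P w \<bullet> ?P w \<le> \<bar>- 1\<bar> * (KA\<^sup>2 / (2 * lam)) * (norm (?P w) * norm w)"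
    by (rule weak_lyapunov_bound) (simp add: lyapunov_sol_satisfies[OF assms])
  then have "norm (?P w) * norm (?P w) \<le> norm (?P w) * (KA\<^sup>2 / (2 * lam) * norm w)"
    by (simp add: norm_eq_sqrt_inner algebra_simps)
  then show "norm (?P w) \<le> KA\<^sup>2 / (2 * lam) * norm w"
    using mult_nonneg_nonneg[OF nonneg norm_ge_zero[of w]]
    by (cases "?P w = 0") (simp_all only: mult_le_cancel_left_pos zero_less_norm_iff norm_zero
        not_False_eq_True)
qed

section \<open>Estimates of the drift terms\<close>

lemma norm_b_drift_le:
  fixes Xs :: "real^'m \<Rightarrow> real^'n" and h :: "real^'m \<Rightarrow> real^'d^'m"
  assumes "norm (fderiv Xs y) \<le> MC" "norm (fderiv (fderiv Xs) y) \<le> MC2"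
    and "norm (g (Xs y) y) \<le> Mg" "norm (h y) \<le> Mh" "0 \<le> eps"
  shows "norm (b_drift g h Xs eps sig y) \<le> eps * MC * Mg + sig\<^sup>2 / 2 * MC2 * Mh\<^sup>2"
proof -
  have "0 \<le> MC2"
    using assms(2) norm_ge_zero order_trans by blast
  have "norm (eps *\<^sub>R fderiv Xs y (g (Xs y) y)) \<le> eps * (MC * Mg)"
    using mult_left_mono[OF norm_blinfun_le[OF assms(1,3)] assms(5)] assms(5) by simp
  moreover have "norm (\<Sum>l\<in>UNIV. fderiv (fderiv Xs) y (column l (h y)) (column l (h y)))
      \<le> MC2 * Mh\<^sup>2"
    using norm_blinfun2_le[OF assms(2)] \<open>0 \<le> MC2\<close> assms(4)
    by (intro norm_sum_columns_le[where H = "h y"]) (auto simp: power2_eq_square mult.assoc)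
  then have "norm ((sig\<^sup>2 / 2) *\<^sub>R (\<Sum>l\<in>UNIV. fderiv (fderiv Xs) y (column l (h y)) (column l (h y))))
      \<le> sig\<^sup>2 / 2 * (MC2 * Mh\<^sup>2)"
    by (simp add: mult_left_mono)
  ultimately show ?thesis
    unfolding b_drift_def
    using norm_triangle_ineq4[of "- (eps *\<^sub>R fderiv Xs y (g (Xs y) y))"
        "(sig\<^sup>2 / 2) *\<^sub>R (\<Sum>l\<in>UNIV. fderiv (fderiv Xs) y (column l (h y)) (column l (h y)))"]
    by (simp add: algebra_simps)
qed

lemma norm_N_drift_le:
  fixes Xs :: "real^'m \<Rightarrow> real^'n"
  assumes MC: "norm (fderiv Xs y) \<le> MC" and "0 \<le> eps"
    and MB: "norm (fderiv (fderiv (\<lambda>x. f x y)) (Xs y)) \<le> MB"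
    and MDxg: "norm (fderiv (\<lambda>x. g x y) (Xs y)) \<le> MDxg"
    and f: "norm (f (Xs y + z) y - (A_lin f Xs y z
              + (1 / 2) *\<^sub>R fderiv (fderiv (\<lambda>x. f x y)) (Xs y) z z)) \<le> Cf * norm z ^ 3"
    and g: "norm (g (Xs y + z) y - (g (Xs y) y + fderiv (\<lambda>x. g x y) (Xs y) z)) \<le> Cg * (norm z)\<^sup>2"
  shows "norm (N_drift f g Xs eps z y)
           \<le> eps * MC * MDxg * norm z + (MB / 2 + eps * MC * Cg) * (norm z)\<^sup>2 + Cf * norm z ^ 3"
proof -
  define F where "F = f (Xs y + z) y - A_lin f Xs y z"
  define G where "G = g (Xs y + z) y - g (Xs y) y"
  have "norm F \<le> MB / 2 * (norm z)\<^sup>2 + Cf * norm z ^ 3"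
  proof -
    have "norm ((1 / 2) *\<^sub>R fderiv (fderiv (\<lambda>x. f x y)) (Xs y) z z) \<le> MB / 2 * (norm z)\<^sup>2"
      using norm_blinfun2_le[OF MB, of z z] by (simp add: power2_eq_square mult.assoc)
    then show ?thesis
      using norm_triangle_sub[of F "(1 / 2) *\<^sub>R fderiv (fderiv (\<lambda>x. f x y)) (Xs y) z z"] f
      unfolding F_def diff_diff_eq by linarith
  qed
  moreover have "norm G \<le> MDxg * norm z + Cg * (norm z)\<^sup>2"
    using norm_triangle_sub[of G "fderiv (\<lambda>x. g x y) (Xs y) z"]
      norm_blinfun_le[OF MDxg order_refl[of "norm z"]] g
    unfolding G_def diff_diff_eq by linarith
  then have "norm (eps *\<^sub>R fderiv Xs y G) \<le> eps * (MC * (MDxg * norm z + Cg * (norm z)\<^sup>2))"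
    using mult_left_mono[OF norm_blinfun_le[OF MC] \<open>0 \<le> eps\<close>] \<open>0 \<le> eps\<close> by simp
  moreover have "norm (N_drift f g Xs eps z y) \<le> norm F + norm (eps *\<^sub>R fderiv Xs y G)"
    unfolding N_drift_def F_def G_def by (rule norm_triangle_ineq4)
  ultimately have "norm (N_drift f g Xs eps z y)
      \<le> (MB / 2 * (norm z)\<^sup>2 + Cf * norm z ^ 3)
        + eps * (MC * (MDxg * norm z + Cg * (norm z)\<^sup>2))"
    by linarith
  then show ?thesis
    by (simp add: algebra_simps)
qed

text \<open>The constant \<open>nu\<close> is kept abstract: the bound on \<open>N\<close> is split into its quadratic part,
  which belongs to the decay rate, and its higher-order part only when \<open>|z| \<le> R\<close> is used.\<close>

lemma LV_le:
  fixes Xs :: "real^'m \<Rightarrow> real^'n" and h :: "real^'m \<Rightarrow> real^'d^'m"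
  assumes P: "norm (P_lyap f Xs y) \<le> c2"
    and DP: "norm (fderiv (P_lyap f Xs) y) \<le> MDP"
    and D2P: "norm (fderiv (fderiv (P_lyap f Xs)) y) \<le> MD2P"
    and DX: "norm (fderiv Xs y) \<le> MC"
    and g: "norm (g (Xs y + z) y) \<le> Mg" and h: "norm (h y) \<le> Mh" and eps: "0 \<le> eps"
    and b: "norm (b_drift g h Xs eps sig y) \<le> beta"
    and N: "norm (N_drift f g Xs eps z y) \<le> nu"
  shows "LV f g h Xs eps sig z y
           \<le> - (1 - eps * MDP * Mg - sig\<^sup>2 / 2 * MD2P * Mh\<^sup>2) * (norm z)\<^sup>2
              + 2 * norm z * c2 * nu
              + 2 * norm z * (c2 * beta + sig\<^sup>2 * MDP * MC * Mh\<^sup>2)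
              + sig\<^sup>2 * c2 * MC\<^sup>2 * Mh\<^sup>2"
proof -
  note nonneg = order_trans[OF norm_ge_zero P] order_trans[OF norm_ge_zero DP]
    order_trans[OF norm_ge_zero D2P] order_trans[OF norm_ge_zero DX]
  have 1: "z \<bullet> P_lyap f Xs y (b_drift g h Xs eps sig y) \<le> norm z * (c2 * beta)"
    using abs_inner_le[OF norm_blinfun_le[OF P b], of z] by linarith
  have 2: "z \<bullet> P_lyap f Xs y (N_drift f g Xs eps z y) \<le> norm z * (c2 * nu)"
    using abs_inner_le[OF norm_blinfun_le[OF P N], of z] by linarith
  have "z \<bullet> fderiv (P_lyap f Xs) y (g (Xs y + z) y) z \<le> norm z * (MDP * Mg * norm z)"
    using abs_inner_le[OF norm_blinfun_le[OF norm_blinfun_le[OF DP g] order_refl[of "norm z"]], of z]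
    by linarith
  from mult_left_mono[OF this eps]
  have 3: "eps * (z \<bullet> fderiv (P_lyap f Xs) y (g (Xs y + z) y) z)
             \<le> eps * (norm z * (MDP * Mg * norm z))" .
  have "norm (\<Sum>l\<in>UNIV. fderiv Xs y (column l (h y)) \<bullet> P_lyap f Xs y (fderiv Xs y (column l (h y))))
      \<le> c2 * MC\<^sup>2 * Mh\<^sup>2"
  proof (rule norm_sum_columns_le[OF _ _ h])
    fix l
    let ?u = "column l (h y)"
    let ?x = "fderiv Xs y ?u"
    have u: "norm ?x \<le> MC * norm ?u"
      by (intro norm_blinfun_le DX order_refl)
    have "\<bar>?x \<bullet> P_lyap f Xs y ?x\<bar> \<le> norm ?x * (c2 * (MC * norm ?u))"
      by (intro abs_inner_le norm_blinfun_le P u)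
    also have "\<dots> \<le> (MC * norm ?u) * (c2 * (MC * norm ?u))"
      using nonneg by (intro mult_right_mono u) auto
    finally show "norm (?x \<bullet> P_lyap f Xs y ?x) \<le> c2 * MC\<^sup>2 * (norm ?u)\<^sup>2"
      by (simp add: power2_eq_square algebra_simps)
  qed (use nonneg in auto)
  then have 4: "sig\<^sup>2 * (\<Sum>l\<in>UNIV. fderiv Xs y (column l (h y)) \<bullet>
        P_lyap f Xs y (fderiv Xs y (column l (h y)))) \<le> sig\<^sup>2 * (c2 * MC\<^sup>2 * Mh\<^sup>2)"
    by (intro mult_left_mono) auto
  have "norm (\<Sum>l\<in>UNIV. z \<bullet> fderiv (fderiv (P_lyap f Xs)) y (column l (h y)) (column l (h y)) z)
      \<le> (norm z * norm z * MD2P) * Mh\<^sup>2"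
  proof (rule norm_sum_columns_le[OF _ _ h])
    fix l
    let ?u = "column l (h y)"
    show "norm (z \<bullet> fderiv (fderiv (P_lyap f Xs)) y ?u ?u z)
        \<le> (norm z * norm z * MD2P) * (norm ?u)\<^sup>2"
      using abs_inner_le[OF norm_blinfun3_le[OF D2P, of ?u ?u z], of z]
      by (simp add: power2_eq_square algebra_simps)
  qed (use nonneg in auto)
  then have 5: "sig\<^sup>2 / 2 * (\<Sum>l\<in>UNIV. z \<bullet>
        fderiv (fderiv (P_lyap f Xs)) y (column l (h y)) (column l (h y)) z)
      \<le> sig\<^sup>2 / 2 * ((norm z * norm z * MD2P) * Mh\<^sup>2)"
    by (intro mult_left_mono) auto
  have "norm (\<Sum>l\<in>UNIV. z \<bullet> fderiv (P_lyap f Xs) y (column l (h y)) (fderiv Xs y (column l (h y))))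
      \<le> (norm z * MDP * MC) * Mh\<^sup>2"
  proof (rule norm_sum_columns_le[OF _ _ h])
    fix l
    let ?u = "column l (h y)"
    show "norm (z \<bullet> fderiv (P_lyap f Xs) y ?u (fderiv Xs y ?u))
        \<le> (norm z * MDP * MC) * (norm ?u)\<^sup>2"
      using abs_inner_le[OF norm_blinfun_le[OF norm_blinfun_le[OF DP order_refl[of "norm ?u"]]
            norm_blinfun_le[OF DX order_refl[of "norm ?u"]]], of z]
      by (simp add: power2_eq_square algebra_simps)
  qed (use nonneg in auto)
  then have 6: "- (2 * sig\<^sup>2 * (\<Sum>l\<in>UNIV. z \<bullet>
        fderiv (P_lyap f Xs) y (column l (h y)) (fderiv Xs y (column l (h y)))))
      \<le> 2 * sig\<^sup>2 * ((norm z * MDP * MC) * Mh\<^sup>2)"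
    unfolding mult_minus_right[symmetric] by (intro mult_left_mono) auto
  have "LV f g h Xs eps sig z y \<le> - (norm z)\<^sup>2 + 2 * (norm z * (c2 * beta)) + 2 * (norm z * (c2 * nu))
      + eps * (norm z * (MDP * Mg * norm z)) + sig\<^sup>2 * (c2 * MC\<^sup>2 * Mh\<^sup>2)
      + sig\<^sup>2 / 2 * ((norm z * norm z * MD2P) * Mh\<^sup>2) + 2 * sig\<^sup>2 * ((norm z * MDP * MC) * Mh\<^sup>2)"
    unfolding LV_def using 1 2 3 4 5 6 by linarith
  then show ?thesis
    by (simp add: power2_eq_square algebra_simps)
qed

text \<open>Young's inequality, weighted so that the square of \<open>r\<close> carries a quarter of \<open>l\<close>.\<close>

lemma mult_le_absorb_square:
  fixes r B l :: real
  assumes "0 < l"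
  shows "2 * r * B \<le> l / 4 * r\<^sup>2 + 4 / l * B\<^sup>2"
proof -
  have "0 \<le> (l * r - 4 * B)\<^sup>2 / (4 * l)"
    using assms by simp
  also have "\<dots> = l / 4 * r\<^sup>2 + 4 / l * B\<^sup>2 - 2 * r * B"
    using assms by (simp add: field_simps power2_eq_square)
  finally show ?thesis by simp
qed

theorem lemma4p8:
  fixes f :: "real^'n \<Rightarrow> real^'m \<Rightarrow> real^'n"
    and g :: "real^'n \<Rightarrow> real^'m \<Rightarrow> real^'m"
    and h :: "real^'m \<Rightarrow> real^'d^'m"
    and Xs :: "real^'m \<Rightarrow> real^'n"
    and K Om :: "(real^'m) set"
    and U :: "((real^'n) \<times> (real^'m)) set"
    and eps sig lam0 KA R0 R Cf Cg c2 :: real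
    and MC MC2 Mg MDxg Mh MB MDP MD2P Gam1 Gam2 beta lamt gamV D0 :: real
  assumes eps: "0 < eps" and sig: "0 < sig"
    and f_C4: "Ck_on 4 (\<lambda>(x, y). f x y) UNIV"
    and g_C2: "Ck_on 2 (\<lambda>(x, y). g x y) UNIV"
    and h_C2: "Ck_on 2 h UNIV"
    and K: "compact K" "K \<noteq> {}"
    and Xs_C3: "open Om" "K \<subseteq> Om" "Ck_on 3 Xs Om"
    and Xs_zero: "\<And>y. y \<in> K \<Longrightarrow> f (Xs y) y = 0"
    and lam0: "lam0 = spectral_gap f Xs K" "0 < lam0"
    and KA: "1 \<le> KA"
    and semigroup: "\<And>t y. 0 \<le> t \<Longrightarrow> y \<in> K \<Longrightarrow>
          norm (exp_op (t *\<^sub>R A_lin f Xs y)) \<le> KA * exp (- lam0 * t)"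
    and c2: "c2 = KA\<^sup>2 / (2 * lam0)"
    and U: "\<And>z y. norm z \<le> R \<Longrightarrow> y \<in> K \<Longrightarrow> (Xs y + z, y) \<in> U"
    and finite_sups:
          "bounded (fderiv Xs ` K)"
          "bounded (fderiv (fderiv Xs) ` K)"
          "bounded ((\<lambda>(x, y). g x y) ` U)"
          "bounded ((\<lambda>(x, y). fderiv (\<lambda>x'. g x' y) x) ` U)"
          "bounded (h ` K)"
          "bounded ((\<lambda>y. fderiv (fderiv (\<lambda>x. f x y)) (Xs y)) ` K)"
          "bounded (fderiv (P_lyap f Xs) ` K)"
          "bounded (fderiv (fderiv (P_lyap f Xs)) ` K)"
    and MC: "MC = (SUP y\<in>K. norm (fderiv Xs y))"
    and MC2: "MC2 = (SUP y\<in>K. norm (fderiv (fderiv Xs) y))"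
    and Mg: "Mg = (SUP (x, y)\<in>U. norm (g x y))"
    and MDxg: "MDxg = (SUP (x, y)\<in>U. norm (fderiv (\<lambda>x'. g x' y) x))"
    and Mh: "Mh = (SUP y\<in>K. norm (h y))"
    and MB: "MB = (SUP y\<in>K. norm (fderiv (fderiv (\<lambda>x. f x y)) (Xs y)))"
    and MDP: "MDP = (SUP y\<in>K. norm (fderiv (P_lyap f Xs) y))"
    and MD2P: "MD2P = (SUP y\<in>K. norm (fderiv (fderiv (P_lyap f Xs)) y))"
    and pos: "0 < R0" "0 < Cf" "0 < Cg"
    and f_taylor: "\<And>z y. norm z \<le> R0 \<Longrightarrow> y \<in> K \<Longrightarrow>
          norm (f (Xs y + z) y - (A_lin f Xs y z
                  + (1 / 2) *\<^sub>R fderiv (fderiv (\<lambda>x. f x y)) (Xs y) z z)) \<le> Cf * norm z ^ 3"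
    and g_taylor: "\<And>z y. norm z \<le> R0 \<Longrightarrow> y \<in> K \<Longrightarrow>
          norm (g (Xs y + z) y - (g (Xs y) y + fderiv (\<lambda>x. g x y) (Xs y) z)) \<le> Cg * (norm z)\<^sup>2"
    and R: "0 < R" "R \<le> R0"
    and Gam1: "Gam1 = eps * MC * MDxg"
    and Gam2: "Gam2 = MB / 2 + eps * MC * Cg"
    and beta: "beta = eps * MC * Mg + sig\<^sup>2 / 2 * MC2 * Mh\<^sup>2"
    and lamt: "lamt = 1 - 2 * c2 * Gam1 - eps * MDP * Mg - sig\<^sup>2 / 2 * MD2P * Mh\<^sup>2"
    and R_choice: "2 * c2 * (Gam2 + eps * MDP * MDxg) * R + 2 * c2 * Cf * R\<^sup>2 \<le> lamt / 4"
    and gamV: "gamV = lamt / (2 * c2)"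
    and D0: "D0 = sig\<^sup>2 * c2 * MC\<^sup>2 * Mh\<^sup>2
                  + 4 / lamt * (c2 * beta + sig\<^sup>2 * MDP * MC * Mh\<^sup>2)\<^sup>2"
  shows "0 < lamt \<and>
         (\<forall>z y. norm z \<le> R \<and> y \<in> K \<longrightarrow>
            LV f g h Xs eps sig z y \<le> - gamV * V_lyap f Xs z y + D0)"
proof -
  have c2_pos: "0 < c2"
    using KA lam0(2) by (simp add: c2)
  have U0: "(Xs y, y) \<in> U" if "y \<in> K" for y
    using U[of 0 y] R(1) that by simp
  have MC': "norm (fderiv Xs y) \<le> MC" if "y \<in> K" for y
    unfolding MC by (rule norm_le_SUP_norm) (use finite_sups that in auto)
  have MC2': "norm (fderiv (fderiv Xs) y) \<le> MC2" if "y \<in> K" for y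
    unfolding MC2 by (rule norm_le_SUP_norm) (use finite_sups that in auto)
  have Mg': "norm (g x y) \<le> Mg" if "(x, y) \<in> U" for x y
    using norm_le_SUP_norm[OF finite_sups(3) that] by (simp add: Mg case_prod_beta)
  have MDxg': "norm (fderiv (\<lambda>x'. g x' y) x) \<le> MDxg" if "(x, y) \<in> U" for x y
    using norm_le_SUP_norm[OF finite_sups(4) that] by (simp add: MDxg case_prod_beta)
  have Mh': "norm (h y) \<le> Mh" if "y \<in> K" for y
    unfolding Mh by (rule norm_le_SUP_norm) (use finite_sups that in auto)
  have MB': "norm (fderiv (fderiv (\<lambda>x. f x y)) (Xs y)) \<le> MB" if "y \<in> K" for y
    unfolding MB by (rule norm_le_SUP_norm) (use finite_sups that in auto)
  have MDP': "norm (fderiv (P_lyap f Xs) y) \<le> MDP" if "y \<in> K" for y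
    unfolding MDP by (rule norm_le_SUP_norm) (use finite_sups that in auto)
  have MD2P': "norm (fderiv (fderiv (P_lyap f Xs)) y) \<le> MD2P" if "y \<in> K" for y
    unfolding MD2P by (rule norm_le_SUP_norm) (use finite_sups that in auto)
  obtain y0 where y0: "y0 \<in> K"
    using K(2) by blast
  have nonneg: "0 \<le> MC" "0 \<le> MB" "0 \<le> MDP" "0 \<le> MDxg"
    using order_trans[OF norm_ge_zero MC'[OF y0]] order_trans[OF norm_ge_zero MB'[OF y0]]
      order_trans[OF norm_ge_zero MDP'[OF y0]] order_trans[OF norm_ge_zero MDxg'[OF U0[OF y0]]]
    by auto
  have Gam2_nonneg: "0 \<le> Gam2"
    using nonneg eps pos by (simp add: Gam2)
  have slack: "0 \<le> 2 * c2 * (eps * MDP * MDxg) * R"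
    using nonneg eps c2_pos R(1) by simp
  have lamt_pos: "0 < lamt"
  proof -
    have "0 \<le> 2 * c2 * (Gam2 + eps * MDP * MDxg) * R" "0 < 2 * c2 * Cf * R\<^sup>2"
      using nonneg Gam2_nonneg eps c2_pos R(1) pos by auto
    with R_choice show ?thesis by linarith
  qed
  moreover have "LV f g h Xs eps sig z y \<le> - gamV * V_lyap f Xs z y + D0"
    if z: "norm z \<le> R" and y: "y \<in> K" for z y
  proof -
    define r where "r = norm z"
    define B where "B = c2 * beta + sig\<^sup>2 * MDP * MC * Mh\<^sup>2"
    have r: "0 \<le> r" "r \<le> R" "r \<le> R0"
      using z R(2) by (auto simp: r_def)
    have P: "norm (P_lyap f Xs y) \<le> c2"
      unfolding P_lyap_def c2
      by (rule norm_lyapunov_sol_le, unfold_locales) (use lam0(2) semigroup y in auto)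
    have "norm (b_drift g h Xs eps sig y) \<le> beta"
      unfolding beta
      by (rule norm_b_drift_le) (use MC' MC2' Mg' Mh' U0 y eps in auto)
    moreover have "norm (N_drift f g Xs eps z y) \<le> Gam1 * r + Gam2 * r\<^sup>2 + Cf * r ^ 3"
      unfolding Gam1 Gam2 r_def
      by (rule norm_N_drift_le) (use MC' MB' MDxg' U0 f_taylor g_taylor r y eps in \<open>auto simp: r_def\<close>)
    ultimately have "LV f g h Xs eps sig z y
        \<le> - (1 - eps * MDP * Mg - sig\<^sup>2 / 2 * MD2P * Mh\<^sup>2) * r\<^sup>2
          + 2 * r * c2 * (Gam1 * r + Gam2 * r\<^sup>2 + Cf * r ^ 3) + 2 * r * B
          + sig\<^sup>2 * c2 * MC\<^sup>2 * Mh\<^sup>2"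
      unfolding r_def B_def
      by (intro LV_le P) (use MC' MDP' MD2P' Mg' Mh' U y z eps in auto)
    \<comment> \<open>The \<open>Gam1\<close> part of the bound on \<open>N\<close> is quadratic after multiplication by \<open>r\<close> and joins
      the decay rate.\<close>
    also have "\<dots> = - lamt * r\<^sup>2 + (2 * c2 * Gam2 * r + 2 * c2 * Cf * r\<^sup>2) * r\<^sup>2 + 2 * r * B
          + sig\<^sup>2 * c2 * MC\<^sup>2 * Mh\<^sup>2"
      by (simp add: lamt power2_eq_square power3_eq_cube algebra_simps)
    also have "(2 * c2 * Gam2 * r + 2 * c2 * Cf * r\<^sup>2) * r\<^sup>2 \<le> lamt / 4 * r\<^sup>2"
    proof (rule mult_right_mono)
      have "2 * c2 * Gam2 * r + 2 * c2 * Cf * r\<^sup>2 \<le> 2 * c2 * Gam2 * R + 2 * c2 * Cf * R\<^sup>2"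
        using r Gam2_nonneg c2_pos pos by (intro add_mono mult_left_mono power_mono) auto
      also have "\<dots> \<le> lamt / 4"
        using R_choice slack by (simp add: algebra_simps)
      finally show "2 * c2 * Gam2 * r + 2 * c2 * Cf * r\<^sup>2 \<le> lamt / 4" .
    qed simp
    also have "2 * r * B \<le> lamt / 4 * r\<^sup>2 + 4 / lamt * B\<^sup>2"
      by (rule mult_le_absorb_square[OF lamt_pos])
    finally have "LV f g h Xs eps sig z y \<le> - (lamt / 2 * r\<^sup>2) + D0"
      by (simp add: D0 B_def)
    moreover have "gamV * V_lyap f Xs z y \<le> lamt / 2 * r\<^sup>2"
    proof -
      have "V_lyap f Xs z y \<le> r * (c2 * r)"
        using abs_inner_le[OF norm_blinfun_le[OF P order_refl[of "norm z"]], of z]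
        by (simp add: V_lyap_def r_def)
      then have "gamV * V_lyap f Xs z y \<le> gamV * (r * (c2 * r))"
        using lamt_pos c2_pos by (intro mult_left_mono) (auto simp: gamV)
      also have "\<dots> = lamt / 2 * r\<^sup>2"
        using c2_pos by (simp add: gamV power2_eq_square)
      finally show ?thesis .
    qed
    ultimately show ?thesis by simp
  qed
  ultimately show ?thesis by blast
qed

end
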